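(* Let $(V,b)$ be an orthogonal bilinear space over $\mathbb{F}_2$ with $\dim V$ even. If $F,L\in \mathrm{Iso}(V,b)$ then $(mF)(mL)=FL$. In particular, if $F$ is an involution then $mF$ is also an involution.
   Context: A bilinear space over $\mathbb{F}_2$ is a finite-dimensional $\mathbb{F}_2$-vector space $V$ with a nondegenerate symmetric bilinear form $b$; it is orthogonal if it is isomorphic to $\mathbb{F}_2^n$ with the standard dot product for some $n\ge1$. $\mathrm{Iso}(V,b)$ is the group of linear automorphisms $f$ of $V$ with $b(f(x),f(y))=b(x,y)$ for all $x,y$. An involution is an element $F$ with $F^2=\mathrm{Id}$ (the identity is included). The distinguished vector $\Omega\in V$ is the unique vector with $b(\Omega,v)=b(v,v)$ for all $v\in V$. For $\dim V$ even and $L\in\mathrm{Iso}(V,b)$, the mirror $mL\in\mathrm{Iso}(V,b)$ is defined by $mL(v)=L(v)+b(v,\Omega)\Omega$. *)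

theory Defs
  imports "HOL-Library.Z2" "Jordan_Normal_Form.Matrix"
begin

text \<open>The field with two elements is the type \<^typ>\<open>bit\<close>.  A vector space over it is
  given by a scalar multiplication on a type, through the locale
  \<^locale>\<open>vector_space\<close>.\<close>

locale bilinear_space = vector_space scale
  for scale :: "bit \<Rightarrow> 'v::ab_group_add \<Rightarrow> 'v" +
  fixes b :: "'v \<Rightarrow> 'v \<Rightarrow> bit"
  assumes finite_dim: "\<exists>B. finite B \<and> span B = UNIV"
    and linear_left: "\<And>y. Vector_Spaces.linear scale (*) (\<lambda>x. b x y)"
    and linear_right: "\<And>x. Vector_Spaces.linear scale (*) (\<lambda>y. b x y)"
    and symmetric: "\<And>x y. b x y = b y x"
    and nondegenerate: "\<And>x. (\<And>y. b x y = 0) \<Longrightarrow> x = 0"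

definition isomorphic_to_dot_product ::
    "(bit \<Rightarrow> 'v::ab_group_add \<Rightarrow> 'v) \<Rightarrow> ('v \<Rightarrow> 'v \<Rightarrow> bit) \<Rightarrow> nat \<Rightarrow> bool" where
  "isomorphic_to_dot_product scale b n \<longleftrightarrow>
     (\<exists>\<phi> :: 'v \<Rightarrow> bit vec.
        bij_betw \<phi> UNIV (carrier_vec n) \<and>
        (\<forall>x y. \<phi> (x + y) = \<phi> x + \<phi> y) \<and>
        (\<forall>c x. \<phi> (scale c x) = c \<cdot>\<^sub>v \<phi> x) \<and>
        (\<forall>x y. \<phi> x \<bullet> \<phi> y = b x y))"

locale orthogonal_space = bilinear_space +
  assumes orthogonal: "\<exists>n\<ge>1. isomorphic_to_dot_product scale b n"

definition Iso ::
    "(bit \<Rightarrow> 'v::ab_group_add \<Rightarrow> 'v) \<Rightarrow> ('v \<Rightarrow> 'v \<Rightarrow> bit) \<Rightarrow> ('v \<Rightarrow> 'v) monoid" where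
  "Iso scale b =
     \<lparr>carrier = {f. Vector_Spaces.linear scale scale f \<and> bij f \<and> (\<forall>x y. b (f x) (f y) = b x y)},
      mult = (\<circ>), one = id\<rparr>"

text \<open>The identity counts as an involution.\<close>

definition involution ::
    "(bit \<Rightarrow> 'v::ab_group_add \<Rightarrow> 'v) \<Rightarrow> ('v \<Rightarrow> 'v \<Rightarrow> bit) \<Rightarrow> ('v \<Rightarrow> 'v) \<Rightarrow> bool" where
  "involution scale b F \<longleftrightarrow>
     F \<in> carrier (Iso scale b) \<and> F \<otimes>\<^bsub>Iso scale b\<^esub> F = \<one>\<^bsub>Iso scale b\<^esub>"

text \<open>Existence and uniqueness are proved below for orthogonal spaces.\<close>

definition Omega :: "('v \<Rightarrow> 'v \<Rightarrow> bit) \<Rightarrow> 'v" where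
  "Omega b = (THE w. \<forall>v. b w v = b v v)"

text \<open>An element of the isometry group only in even dimension, see \<open>mirror_in_Iso\<close> below.\<close>

definition mirror ::
    "(bit \<Rightarrow> 'v::ab_group_add \<Rightarrow> 'v) \<Rightarrow> ('v \<Rightarrow> 'v \<Rightarrow> bit) \<Rightarrow> ('v \<Rightarrow> 'v) \<Rightarrow> 'v \<Rightarrow> 'v" where
  "mirror scale b L = (\<lambda>v. L v + scale (b v (Omega b)) (Omega b))"


subsection \<open>The definitions are meaningful\<close>

context bilinear_space
begin

lemma b_add_left: "b (x + y) z = b x z + b y z"
  using linear_left[of z] by (simp add: linear_iff_module_hom module_hom_iff)

lemma b_scale_left: "b (scale c x) z = c * b x z"
  using linear_left[of z] by (simp add: linear_iff_module_hom module_hom_iff)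

lemma b_add_right: "b z (x + y) = b z x + b z y"
  using b_add_left symmetric by metis

lemma b_scale_right: "b z (scale c x) = c * b z x"
  using b_scale_left symmetric by metis

lemma b_zero_left [simp]: "b 0 z = 0"
  using b_scale_left[of 0 0 z] by simp

lemma b_sum_left: "b (\<Sum>i\<in>I. f i) z = (\<Sum>i\<in>I. b (f i) z)"
  by (induction I rule: infinite_finite_induct) (simp_all add: b_add_left)

lemma eq_if_b_eq:
  assumes "\<And>z. b x z = b y z" shows "x = y"
proof -
  have "b (x - y) z = 0" for z
    using b_add_left[of "x - y" y z] assms[of z]
    by (simp del: add_bit_eq_xor)
  then show ?thesis using nondegenerate[of "x - y"] by simp
qed

lemma group_Iso: "group (Iso scale b)"
proof (rule groupI)
  fix f g assume "f \<in> carrier (Iso scale b)" "g \<in> carrier (Iso scale b)"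
  then show "f \<otimes>\<^bsub>Iso scale b\<^esub> g \<in> carrier (Iso scale b)"
    by (auto simp: Iso_def intro: Vector_Spaces.linear_compose bij_comp)
next
  show "\<one>\<^bsub>Iso scale b\<^esub> \<in> carrier (Iso scale b)"
    by (simp add: Iso_def linear_id)
next
  fix f assume f: "f \<in> carrier (Iso scale b)"
  have lin: "Vector_Spaces.linear scale scale f" and bij: "bij f"
    and iso: "\<And>x y. b (f x) (f y) = b x y"
    using f by (auto simp: Iso_def)
  interpret f: Vector_Spaces.linear scale scale f by (fact lin)
  have f_inv: "f (inv_into UNIV f x) = x" for x
    using bij by (simp add: bij_is_surj surj_f_inv_f)
  have inv_f: "inv_into UNIV f (f x) = x" for x
    using bij by (simp add: bij_is_inj inv_f_f)
  have "Vector_Spaces.linear scale scale (inv_into UNIV f)"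
  proof (unfold_locales)
    show "inv_into UNIV f (x + y) = inv_into UNIV f x + inv_into UNIV f y" for x y
      by (metis f.add f_inv inv_f)
    show "inv_into UNIV f (scale c x) = scale c (inv_into UNIV f x)" for c x
      by (metis f.scale f_inv inv_f)
  qed
  moreover have "bij (inv_into UNIV f)" using bij by (rule bij_betw_inv_into)
  moreover have "b (inv_into UNIV f x) (inv_into UNIV f y) = b x y" for x y
    using iso[of "inv_into UNIV f x" "inv_into UNIV f y"] by (simp add: f_inv)
  ultimately have "inv_into UNIV f \<in> carrier (Iso scale b)" by (simp add: Iso_def)
  moreover have "inv_into UNIV f \<otimes>\<^bsub>Iso scale b\<^esub> f = \<one>\<^bsub>Iso scale b\<^esub>"
    by (auto simp: Iso_def inv_f)
  ultimately show "\<exists>g\<in>carrier (Iso scale b). g \<otimes>\<^bsub>Iso scale b\<^esub> f = \<one>\<^bsub>Iso scale b\<^esub>"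
    by blast
qed (auto simp: Iso_def)

end

context orthogonal_space
begin

lemma orthonormal_basis:
  obtains n :: nat and w :: "nat \<Rightarrow> 'a"
  where "n = dim UNIV" and "\<And>v. (\<Sum>i<n. scale (b v (w i)) (w i)) = v"
    and "\<And>i j. i < n \<Longrightarrow> j < n \<Longrightarrow> b (w i) (w j) = (if i = j then 1 else 0)"
proof -
  obtain n \<phi> where bij: "bij_betw \<phi> UNIV (carrier_vec n)"
    and dot: "\<And>x y. \<phi> x \<bullet> \<phi> y = b x y"
    using orthogonal unfolding isomorphic_to_dot_product_def by blast
  define w where "w i = inv_into UNIV \<phi> (unit_vec n i)" for i
  have car: "\<phi> x \<in> carrier_vec n" for x
    using bij by (auto simp: bij_betw_def)
  have \<phi>w: "\<phi> (w i) = unit_vec n i" for i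
    unfolding w_def using bij by (simp add: bij_betw_inv_into_right)
  have bw: "b v (w i) = \<phi> v $ i" if "i < n" for v i
    using that car[of v] by (simp flip: dot add: \<phi>w)
  have orth: "b (w i) (w j) = (if i = j then 1 else 0)" if "i < n" "j < n" for i j
    using that by (simp add: bw \<phi>w)
  have eqI: "x = y" if "\<And>i. i < n \<Longrightarrow> b x (w i) = b y (w i)" for x y
  proof -
    have "\<phi> x = \<phi> y"
      using that car[of x] car[of y] by (intro eq_vecI) (auto simp: bw)
    then show ?thesis using bij by (auto simp: bij_betw_def inj_on_def)
  qed
  have coeff: "b (\<Sum>i<n. scale (c i) (w i)) (w j) = c j" if "j < n" for c j
  proof -
    have "b (\<Sum>i<n. scale (c i) (w i)) (w j) = (\<Sum>i<n. if i = j then c i else 0)"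
      unfolding b_sum_left by (rule sum.cong) (use that in \<open>auto simp: b_scale_left orth\<close>)
    then show ?thesis using that by simp
  qed
  have exp: "(\<Sum>i<n. scale (b v (w i)) (w i)) = v" for v
    by (rule eqI) (simp only: coeff)
  have inj: "inj_on w {..<n}"
  proof (rule inj_onI)
    fix i j assume ij: "i \<in> {..<n}" "j \<in> {..<n}" "w i = w j"
    then show "i = j" using orth[of i i] orth[of i j] by (auto split: if_splits)
  qed
  have indep: "independent (w ` {..<n})"
  proof (rule independent_if_scalars_zero)
    fix f x assume 0: "(\<Sum>x\<in>w ` {..<n}. scale (f x) x) = 0" and "x \<in> w ` {..<n}"
    then obtain j where j: "j < n" "x = w j" by auto
    have "(\<Sum>i<n. scale (f (w i)) (w i)) = 0"
      using 0 inj by (simp add: sum.reindex)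
    then show "f x = 0" using coeff[of j "\<lambda>i. f (w i)"] j by simp
  qed simp
  have "v \<in> span (w ` {..<n})" for v
    by (subst exp[symmetric]) (intro span_sum span_scale span_base imageI)
  then have "span (w ` {..<n}) = UNIV" by auto
  then have "dim UNIV = card (w ` {..<n})"
    using indep by (metis dim_span dim_eq_card_independent)
  then have "n = dim UNIV" using inj by (simp add: card_image)
  then show thesis using that exp orth by blast
qed

lemma Omega_ex1: "\<exists>!w. \<forall>v. b w v = b v v"
proof -
  obtain n w where "n = dim UNIV" and exp: "\<And>v. (\<Sum>i<n. scale (b v (w i)) (w i)) = v"
    and "\<And>i j. i < n \<Longrightarrow> j < n \<Longrightarrow> b (w i) (w j) = (if i = j then 1 else 0)"
    using orthonormal_basis by metis
  have "b (\<Sum>i<n. w i) v = b v v" for v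
  proof -
    have "b v v = b (\<Sum>i<n. scale (b v (w i)) (w i)) v" by (simp only: exp)
    also have "\<dots> = (\<Sum>i<n. b v (w i) * b (w i) v)" by (simp only: b_sum_left b_scale_left)
    also have "\<dots> = (\<Sum>i<n. b (w i) v)"
      by (rule sum.cong) (auto simp: symmetric[of v])
    finally show ?thesis by (simp only: b_sum_left)
  qed
  then show ?thesis using eq_if_b_eq by (metis (no_types, lifting))
qed

lemma Omega: "b (Omega b) v = b v v"
  using theI'[OF Omega_ex1] unfolding Omega_def by blast

lemma Omega_Omega:
  assumes "even (dim UNIV)"
  shows "b (Omega b) (Omega b) = 0"
proof -
  obtain n w where n: "n = dim UNIV" and exp: "\<And>v. (\<Sum>i<n. scale (b v (w i)) (w i)) = v"
    and orth: "\<And>i j. i < n \<Longrightarrow> j < n \<Longrightarrow> b (w i) (w j) = (if i = j then 1 else 0)"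
    using orthonormal_basis by metis
  have "Omega b = (\<Sum>i<n. scale (b (Omega b) (w i)) (w i))" by (rule exp[symmetric])
  also have "\<dots> = (\<Sum>i<n. w i)" by (rule sum.cong) (auto simp: Omega orth)
  finally have "b (Omega b) (Omega b) = b (\<Sum>i<n. w i) (Omega b)" by simp
  also have "\<dots> = (\<Sum>i<n. b (Omega b) (w i))" by (simp only: b_sum_left symmetric[of "Omega b"])
  also have "\<dots> = (\<Sum>i<n. 1)" by (rule sum.cong) (auto simp: Omega orth)
  also have "\<dots> = of_nat n" by simp
  also have "\<dots> = 0" using assms n by (auto elim!: evenE)
  finally show ?thesis .
qed

lemma Iso_Omega:
  assumes "L \<in> carrier (Iso scale b)"
  shows "L (Omega b) = Omega b"
proof (rule eq_if_b_eq)
  fix z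
  have "surj L" using assms by (simp add: Iso_def bij_is_surj)
  then obtain y where y: "z = L y" by blast
  then show "b (L (Omega b)) z = b (Omega b) z" using assms by (simp add: Iso_def Omega)
qed

lemma mirror_in_Iso:
  assumes "even (dim UNIV)" "L \<in> carrier (Iso scale b)"
  shows "mirror scale b L \<in> carrier (Iso scale b)"
proof -
  define w where "w = Omega b"
  define M where "M = mirror scale b L"
  have M: "M v = L v + scale (b v w) w" for v by (simp add: M_def mirror_def w_def)
  have lin: "Vector_Spaces.linear scale scale L" and bij: "bij L"
    and iso: "\<And>x y. b (L x) (L y) = b x y"
    using assms(2) by (auto simp: Iso_def)
  interpret L: Vector_Spaces.linear scale scale L by (fact lin)
  have Lw: "L w = w" using Iso_Omega[OF assms(2)] by (simp add: w_def)
  have ww: "b w w = 0" using Omega_Omega[OF assms(1)] by (simp add: w_def)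
  have wL: "b w (L v) = b v w" for v using iso[of w v] symmetric[of w v] by (simp add: Lw)
  have Lvw: "b (L v) w = b v w" for v using iso[of v w] by (simp add: Lw)
  have linM: "Vector_Spaces.linear scale scale M"
  proof unfold_locales
    show "M (x + y) = M x + M y" for x y
      by (simp add: M L.add b_add_left scale_left_distrib algebra_simps
          del: add_bit_eq_xor)
    show "M (scale c x) = scale c (M x)" for c x
      by (simp add: M L.scale b_scale_left scale_right_distrib)
  qed
  have isoM: "b (M x) (M y) = b x y" for x y
  proof -
    have "b (M x) (M y) = b x y + b y w * b x w + b x w * b y w"
      by (simp add: M b_add_left b_add_right b_scale_left b_scale_right iso Lvw wL ww
          del: add_bit_eq_xor mult_bit_eq_and)
    also have "\<dots> = b x y" by (cases "b y w"; cases "b x w") auto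
    finally show ?thesis .
  qed
  have "inj M"
  proof (rule injI)
    fix x y assume eq: "M x = M y"
    show "x = y"
    proof (rule eq_if_b_eq)
      show "b x z = b y z" for z using isoM[of x z] isoM[of y z] eq by simp
    qed
  qed
  moreover have "surj M"
  proof (rule surjI)
    fix z
    have Lz: "L (inv_into UNIV L z) = z" using bij by (simp add: bij_is_surj surj_f_inv_f)
    have "M (inv_into UNIV L z + scale (b z w) w) = z + scale (b (inv_into UNIV L z) w + b z w) w"
      by (simp add: M L.add L.scale Lz Lw b_add_left b_scale_left ww scale_left_distrib
          algebra_simps del: add_bit_eq_xor mult_bit_eq_and)
    moreover have "b (inv_into UNIV L z) w = b z w" using Lvw[of "inv_into UNIV L z"] by (simp add: Lz)
    ultimately show "M (inv_into UNIV L z + scale (b z w) w) = z" by simp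
  qed
  ultimately show ?thesis using linM isoM by (simp add: Iso_def bij_def M_def[symmetric])
qed

end

end

theory Submission
  imports Defs
begin

text \<open>Every isometry fixes \<open>Omega b\<close> (\<open>Iso_Omega\<close>), and in even
  dimension \<open>Omega b\<close> is isotropic (\<open>Omega_Omega\<close>). So in the product of
  two mirrors each factor adds the same correction, \<open>b v (Omega b)\<close> times
  \<open>Omega b\<close>, and the two cancel in characteristic 2.\<close>

lemma (in orthogonal_space) mirror_comp_mirror:
  assumes even: "even (dim UNIV)"
    and F: "F \<in> carrier (Iso scale b)" and L: "L \<in> carrier (Iso scale b)"
  shows "mirror scale b F \<circ> mirror scale b L = F \<circ> L"
proof
  fix v
  define w where "w = Omega b"
  interpret F: Vector_Spaces.linear scale scale F using F by (simp add: Iso_def)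
  have Fw: "F w = w" and Lw: "L w = w" and ww: "b w w = 0"
    using Iso_Omega[OF F] Iso_Omega[OF L] Omega_Omega[OF even] by (simp_all add: w_def)
  \<comment> \<open>Since \<open>L\<close> fixes \<open>w\<close>, the outer mirror, applied to
    \<open>L v\<close>, has the same coefficient \<open>b v w\<close> as the inner one.\<close>
  have "b (L v) (L w) = b v w" using L by (simp add: Iso_def)
  then have Lvw: "b (L v) w = b v w" by (simp only: Lw)
  have "(mirror scale b F \<circ> mirror scale b L) v
      = F (L v) + scale (b v w) w + scale (b v w) w"
    by (simp add: mirror_def w_def[symmetric] F.add F.scale Fw b_add_left b_scale_left Lvw ww
        del: add_bit_eq_xor mult_bit_eq_and)
  \<comment> \<open>Collecting the corrections leaves a scalar of the form \<open>c + c\<close>,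
    which is 0 in \<open>bit\<close>.\<close>
  also have "\<dots> = F (L v) + scale (b v w + b v w) w"
    by (simp only: scale_left_distrib add.assoc)
  finally show "(mirror scale b F \<circ> mirror scale b L) v = (F \<circ> L) v" by simp
qed

theorem proposition2p6:
  fixes scale :: "bit \<Rightarrow> 'v::ab_group_add \<Rightarrow> 'v" and b :: "'v \<Rightarrow> 'v \<Rightarrow> bit"
  assumes "orthogonal_space scale b"
    and "even (vector_space.dim scale (UNIV :: 'v set))"
  shows "(\<forall>F\<in>carrier (Iso scale b). \<forall>L\<in>carrier (Iso scale b).
            mirror scale b F \<otimes>\<^bsub>Iso scale b\<^esub> mirror scale b L = F \<otimes>\<^bsub>Iso scale b\<^esub> L)
       \<and> (\<forall>F. involution scale b F \<longrightarrow> involution scale b (mirror scale b F))"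
proof -
  interpret orthogonal_space scale b by (fact assms(1))
  have mult: "f \<otimes>\<^bsub>Iso scale b\<^esub> g = f \<circ> g" for f g
    by (simp add: Iso_def)
  show ?thesis
    \<comment> \<open>The second claim is the case \<open>L = F\<close>: the square of the mirror is
      the square of \<open>F\<close>, hence the identity, and \<open>mirror_in_Iso\<close> gives
      membership in the group.\<close>
    using mirror_comp_mirror[OF assms(2)] mirror_in_Iso[OF assms(2)]
    by (simp add: involution_def mult)
qed

end
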